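(* Let $k$ be a positive integer with $4\mid k$, and let $p$ be a prime with $p \equiv 7 \pmod 8$. Let $n$ be a positive integer with $n\equiv 1 \pmod 8$ and $n<p$, such that either $n=1$ or every prime factor of $n$ is congruent to $1 \pmod 4$. Then there are no positive integers $x,y,z$ with $x^2+y^2+z^k=(np)^2$. *)

theory Defs
  imports "HOL-Number_Theory.Number_Theory"
begin

end

theory Submission
  imports Defs
begin

text \<open>
  With \<open>w = z ^ (k div 4)\<close> and \<open>N = n * p\<close> the equation reads
  \<open>x\<^sup>2 + y\<^sup>2 = (N - w\<^sup>2) * (N + w\<^sup>2)\<close>. Congruences modulo 8 show that \<open>N - w\<^sup>2\<close> or its
  half is 3 modulo 4, so some prime \<open>q \<equiv> 3 (mod 4)\<close> divides it to an odd power. As \<open>q\<close> divides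
  a sum of two squares to an even power, it also divides \<open>N + w\<^sup>2\<close>, hence both \<open>N\<close> and \<open>w\<close>.
  The prime factors of \<open>n\<close> being 1 modulo 4, \<open>q = p\<close>; then \<open>w\<^sup>2 \<ge> p\<^sup>2 > N\<close>, which is impossible.
\<close>

text \<open>If \<open>q\<close> does not divide \<open>x\<close>, it does not divide
  \<open>y\<close> either. Raising \<open>x\<^sup>2 = - y\<^sup>2\<close> modulo \<open>q\<close> to
  the power \<open>(q - 1) / 2\<close>, which is odd because \<open>q\<close> is 3 modulo 4, then
  gives 1 = -1 by Fermat's little theorem.\<close>

lemma prime_3_mod_4_dvd_sum_squares:
  fixes q x y :: nat
  assumes q: "prime q" "q mod 4 = 3" and dvd: "q dvd x\<^sup>2 + y\<^sup>2"
  shows "q dvd x"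
proof (rule ccontr)
  assume x: "\<not> q dvd x"
  have y: "\<not> q dvd y"
  proof
    assume "q dvd y"
    then have "q dvd y\<^sup>2"
      by (simp add: power2_eq_square)
    then have "q dvd x\<^sup>2"
      using dvd by (simp add: dvd_add_left_iff)
    then show False
      using x q(1) prime_dvd_power by blast
  qed
  define m where "m = (q - 1) div 2"
  have "odd m" "2 * m = q - 1"
    using q(2) unfolding m_def by presburger+
  have "int q dvd int (x\<^sup>2 + y\<^sup>2)"
    using dvd by (simp only: int_dvd_int_iff)
  then have "[(int x)\<^sup>2 = - ((int y)\<^sup>2)] (mod int q)"
    by (simp add: cong_iff_dvd_diff)
  then have "[((int x)\<^sup>2) ^ m = (- ((int y)\<^sup>2)) ^ m] (mod int q)"
    by (rule cong_pow)
  then have "[int x ^ (q - 1) = - (int y ^ (q - 1))] (mod int q)"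
    using \<open>odd m\<close> \<open>2 * m = q - 1\<close> by (simp flip: power_mult)
  moreover have "[int x ^ (q - 1) = 1] (mod int q)" "[int y ^ (q - 1) = 1] (mod int q)"
    using fermat_theorem[OF q(1) x] fermat_theorem[OF q(1) y] by (simp_all flip: cong_int_iff)
  ultimately have "[1 = - 1] (mod int q)"
    by (meson cong_minus_minus_iff cong_sym cong_trans)
  then have "int q dvd 2"
    by (simp add: cong_iff_dvd_diff)
  then have "q \<le> 2"
    using zdvd_imp_le by fastforce
  then show False
    using q(2) by (simp add: le_Suc_eq numeral_2_eq_2) presburger
qed

text \<open>Descent on \<open>x\<close>: if \<open>q\<close> divides the sum, it divides both
  \<open>x\<close> and \<open>y\<close>, and cancelling \<open>q\<^sup>2\<close> lowers the
  multiplicity by exactly 2. Positivity of \<open>x\<close> passes to \<open>a\<close> and keeps the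
  sums nonzero.\<close>

lemma even_multiplicity_sum_squares:
  fixes q x y :: nat
  assumes q: "prime q" "q mod 4 = 3" and "x > 0"
  shows "even (multiplicity q (x\<^sup>2 + y\<^sup>2))"
  using \<open>x > 0\<close>
proof (induction x arbitrary: y rule: less_induct)
  case (less x)
  show ?case
  proof (cases "q dvd x\<^sup>2 + y\<^sup>2")
    case True
    then have "q dvd x" "q dvd y"
      using prime_3_mod_4_dvd_sum_squares[OF q, of x y]
        prime_3_mod_4_dvd_sum_squares[OF q, of y x] by (simp_all add: add.commute)
    then obtain a b where ab: "x = q * a" "y = q * b"
      by blast
    have "a > 0" "a < x"
      using less.prems prime_gt_1_nat[OF q(1)] by (auto simp: ab)
    have "x\<^sup>2 + y\<^sup>2 = q\<^sup>2 * (a\<^sup>2 + b\<^sup>2)"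
      by (simp add: ab algebra_simps power2_eq_square)
    then have "multiplicity q (x\<^sup>2 + y\<^sup>2) = 2 + multiplicity q (a\<^sup>2 + b\<^sup>2)"
      using q(1) \<open>a > 0\<close>
      by (simp add: prime_elem_multiplicity_mult_distrib prime_gt_0_nat)
    then show ?thesis
      using less.IH[OF \<open>a < x\<close> \<open>a > 0\<close>] by simp
  qed (simp add: not_dvd_imp_multiplicity_0)
qed

text \<open>Otherwise every prime power in the factorization of \<open>a\<close> would be 1 modulo
  4, since an even power of a prime that is 3 modulo 4 is a power of 9, and so would
  \<open>a\<close>.\<close>

lemma odd_multiplicity_if_3_mod_4:
  fixes a :: nat
  assumes "a mod 4 = 3"
  obtains q where "prime q" "q mod 4 = 3" "odd (multiplicity q a)"
proof (rule ccontr)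
  assume "\<not> thesis"
  with that have even: "even (multiplicity q a)" if "prime q" "q mod 4 = 3" for q
    using that by blast
  have "a > 0" "odd a"
    using assms by presburger+
  have "[q ^ multiplicity q a = 1] (mod 4)" if "q \<in> prime_factors a" for q
  proof -
    have "prime q" "odd q"
      using that \<open>odd a\<close> by (auto dest: dvd_trans)
    have "q mod 4 = 1 \<or> q mod 4 = 3"
      using \<open>odd q\<close> by presburger
    then consider "q mod 4 = 1" | "q mod 4 = 3"
      by blast
    then show ?thesis
    proof cases
      case 1
      then have "[q = 1] (mod 4)"
        by (simp add: cong_def)
      then show ?thesis
        using cong_pow by fastforce
    next
      case 2
      then obtain j where "multiplicity q a = 2 * j"
        using even \<open>prime q\<close> by blast
      moreover have "[q\<^sup>2 = 1] (mod 4)"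
        using 2 by (simp add: cong_def power_mod[of q 4 2, symmetric])
      ultimately show ?thesis
        using cong_pow[of "q\<^sup>2" 1 4 j] by (simp add: power_mult)
    qed
  qed
  then have "[(\<Prod>q\<in>prime_factors a. q ^ multiplicity q a) = (\<Prod>q\<in>prime_factors a. 1)] (mod 4)"
    by (rule cong_prod)
  then have "[a = 1] (mod 4)"
    using prime_factorization_nat[OF \<open>a > 0\<close>] by simp
  with assms show False
    by (simp add: cong_def)
qed

lemma no_sum_squares_fourth_power:
  fixes n p w x y :: nat
  assumes p: "prime p" "p mod 8 = 7" and n: "n mod 8 = 1" "n < p"
    and factors: "\<And>q. prime q \<Longrightarrow> q dvd n \<Longrightarrow> q mod 4 = 1"
    and pos: "x > 0" "w > 0"
  shows "x\<^sup>2 + y\<^sup>2 + w ^ 4 \<noteq> (n * p)\<^sup>2"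
proof
  assume eq: "x\<^sup>2 + y\<^sup>2 + w ^ 4 = (n * p)\<^sup>2"
  define N where "N = n * p"
  have N: "N mod 8 = 7"
    using p(2) n(1) mod_mult_eq[of n 8 p] by (simp add: N_def)
  \<comment> \<open>The inequality is strict because \<open>x > 0\<close>; hence the natural-number
    subtraction defining \<open>a\<close> is exact and \<open>a\<close> is positive.\<close>
  have "(w\<^sup>2)\<^sup>2 < N\<^sup>2"
    using eq pos by (auto simp: N_def simp flip: eq power_mult)
  then have "w\<^sup>2 < N"
    by (rule power_less_imp_less_base) simp
  define a where "a = N - w\<^sup>2"
  have a: "N = a + w\<^sup>2" "a > 0"
    using \<open>w\<^sup>2 < N\<close> by (simp_all add: a_def)
  have fact_eq: "x\<^sup>2 + y\<^sup>2 = a * (a + 2 * w\<^sup>2)"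
    using eq by (simp flip: N_def) (simp add: a algebra_simps power2_eq_square power4_eq_xxxx)
  \<comment> \<open>Subtracting a square residue from 7 leaves 7, 6 or 3 for \<open>a\<close> modulo
    8.\<close>
  have "w\<^sup>2 mod 8 \<in> {0, 1, 4}"
  proof -
    have "w mod 8 \<in> {0, 1, 2, 3, 4, 5, 6, 7}"
      by auto
    then show ?thesis
      unfolding power_mod[of w 8 2, symmetric] by auto
  qed
  moreover have "(a mod 8 + w\<^sup>2 mod 8) mod 8 = 7"
    using N a(1) by (simp add: mod_add_eq)
  moreover have "a mod 8 \<in> {0, 1, 2, 3, 4, 5, 6, 7}"
    by auto
  ultimately have "a mod 8 = 3 \<or> a mod 8 = 6 \<or> a mod 8 = 7"
    by auto
  then have "a mod 4 = 3 \<or> a mod 8 = 6"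
    by presburger
  \<comment> \<open>The factor \<open>c\<close> strips the single 2 from \<open>a\<close> in the
    case 6 modulo 8. As \<open>q\<close> is odd, it does not affect the multiplicity of
    \<open>q\<close>.\<close>
  then obtain b c where bc: "a = c * b" "b mod 4 = 3" "c = 1 \<or> c = 2"
  proof
    assume "a mod 8 = 6"
    then have "a = 2 * (a div 2)" "a div 2 mod 4 = 3"
      by presburger+
    then show ?thesis
      using that by blast
  qed (use that[of 1 a] in simp)
  obtain q where q: "prime q" "q mod 4 = 3" and odd: "odd (multiplicity q b)"
    using odd_multiplicity_if_3_mod_4[OF bc(2)] .
  have "q \<noteq> 2"
    using q(2) by auto
  then have q2: "\<not> q dvd 2"
    using q(1) primes_dvd_imp_eq two_is_prime_nat by blast
  then have "\<not> q dvd c"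
    using bc(3) q(1) by auto
  then have "multiplicity q a = multiplicity q b"
    using bc q(1) a(2)
    by (simp add: prime_elem_multiplicity_mult_distrib not_dvd_imp_multiplicity_0)
  then have odd_a: "odd (multiplicity q a)"
    using odd by simp
  then have "q dvd a"
    using not_dvd_imp_multiplicity_0 by fastforce
  \<comment> \<open>The two factors of the sum of squares have multiplicities of equal parity, so
    the second is also odd, hence nonzero.\<close>
  have "even (multiplicity q a + multiplicity q (a + 2 * w\<^sup>2))"
    using even_multiplicity_sum_squares[OF q pos(1), of y] q(1) a(2)
    by (simp add: fact_eq prime_elem_multiplicity_mult_distrib)
  then have "odd (multiplicity q (a + 2 * w\<^sup>2))"
    using odd_a by simp
  then have "q dvd a + 2 * w\<^sup>2"
    using not_dvd_imp_multiplicity_0 by fastforce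
  then have "q dvd 2 * w\<^sup>2"
    using \<open>q dvd a\<close> by (simp add: dvd_add_right_iff)
  then have "q dvd w"
    using q(1) q2 by (meson prime_dvd_mult_iff prime_dvd_power)
  then have "q dvd n * p"
    using \<open>q dvd a\<close> a(1) by (simp add: N_def power2_eq_square)
  moreover have "\<not> q dvd n"
    using factors[OF q(1)] q(2) by auto
  ultimately have "q = p"
    using p(1) q(1) by (meson prime_dvd_mult_iff primes_dvd_imp_eq)
  then have "p \<le> w"
    using \<open>q dvd w\<close> pos(2) by (simp add: dvd_imp_le)
  then have "p * p \<le> w\<^sup>2"
    by (simp add: power2_eq_square mult_le_mono)
  moreover have "N \<le> p * p"
    using n(2) by (simp add: N_def)
  ultimately show False
    using \<open>w\<^sup>2 < N\<close> by simp
qed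

theorem theorem2:
  fixes k p n :: nat
  assumes "k > 0" and "4 dvd k"
    and "prime p" and "[p = 7] (mod 8)"
    and "n > 0" and "[n = 1] (mod 8)" and "n < p"
    and "n = 1 \<or> (\<forall>q. prime q \<and> q dvd n \<longrightarrow> [q = 1] (mod 4))"
  shows "\<not> (\<exists>x y z :: nat. x > 0 \<and> y > 0 \<and> z > 0 \<and> x ^ 2 + y ^ 2 + z ^ k = (n * p) ^ 2)"
proof clarify
  fix x y z :: nat
  assume pos: "x > 0" "y > 0" "z > 0" and eq: "x ^ 2 + y ^ 2 + z ^ k = (n * p) ^ 2"
  obtain j where "k = 4 * j"
    using \<open>4 dvd k\<close> by blast
  then have "z ^ k = (z ^ j) ^ 4"
    by (simp add: mult.commute flip: power_mult)
  \<comment> \<open>For \<open>n = 1\<close> this is vacuous, so both alternatives yield the same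
    condition.\<close>
  moreover have "q mod 4 = 1" if "prime q" "q dvd n" for q
    using assms(8) that by (auto simp: cong_def)
  ultimately show False
    using no_sum_squares_fourth_power[of p n x "z ^ j" y] assms(3,4,6,7) pos eq
    by (simp add: cong_def)
qed

end
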